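(* Let $g,h:X\to\mathbb{R}$ and let $A,B\in\mathbb{I}^{n_x\times N}$ be such that $\Gamma(\cdot,A,X)$ and $\Gamma(\cdot,B,X)$ are interval superposition models (ISMs) of $g$ and $h$ on $X$, respectively. Suppose that $C\in\mathbb{I}^{n_x\times N}$ is computed from $A$ and $B$ by the following procedure (product rule). (1) For all $i\in\{1,\ldots,n_x\}$ compute the central points $$a_i=\frac{U(A_i)+L(A_i)}{2},\qquad b_i=\frac{U(B_i)+L(B_i)}{2},$$ and set $$a=\sum_{i=1}^{n_x}a_i,\quad b=\sum_{i=1}^{n_x}b_i,\quad c=\sum_{i=1}^{n_x}a_ib_i,\quad \omega=\frac{ab-c}{n_x}.$$ (2) Compute $\rho_i(A)=\frac{U(A_i)-L(A_i)}{2}$ and $\rho_i(B)=\frac{U(B_i)-L(B_i)}{2}$ for all $i\in\{1,\ldots,n_x\}$, and the remainder bound $$R(A,B)=\left(\sum_{i=1}^{n_x}\rho_i(A)\right)\left(\sum_{i=1}^{n_x}\rho_i(B)\right)-\sum_{i=1}^{n_x}\rho_i(A)\rho_i(B).$$ (3) For all $i\in\{1,\ldots,n_x\}$ and all $j\in\{1,\ldots,N\}$ compute, in interval arithmetic, $$C_i^j=\left(A_i^j+a-a_i\right)\left(B_i^j+b-b_i\right)-(a-a_i)(b-b_i)-\omega .$$ (4) Pick $k\in\operatorname{argmax}_{i\in\{1,\ldots,n_x\}}\sum_{j=1}^{N}\left(\overline{A}_i^j-\underline{A}_i^j\right)$ and replace $C_k^j$ by $C_k^j+R(A,B)\cdot[-1,1]$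 for all $j\in\{1,\ldots,N\}$. Then $\Gamma(\cdot,C,X)$ is an ISM of the product $g*h$ on $X$, i.e. $g(x)h(x)\in\Gamma(x,C,X)$ for all $x\in X$.
   Context: Let $n_x,N\ge 1$ be integers. $\mathbb{I}$ denotes the set of compact intervals $[a,b]\subset\mathbb{R}$ with $a\le b$, and $\mathbb{I}^{n_x\times N}$ the set of $n_x\times N$ matrices with entries in $\mathbb{I}$. The entries of $A\in\mathbb{I}^{n_x\times N}$ are written $A_i^j=[\underline{A}_i^j,\overline{A}_i^j]$, with row index $i\in\{1,\ldots,n_x\}$ and column index $j\in\{1,\ldots,N\}$; $A_i$ is the $i$-th row, and $$L(A_i)=\min_{j\in\{1,\ldots,N\}}\underline{A}_i^j,\qquad U(A_i)=\max_{j\in\{1,\ldots,N\}}\overline{A}_i^j$$ (and likewise for $B$). Interval operations: $[a,b]+[c,d]=[a+c,b+d]$, $c+[a,b]=[a+c,b+c]$, $c[a,b]=[ca,cb]$ if $c\ge 0$ and $c[a,b]=[cb,ca]$ if $c<0$, and $[a,b]*[c,d]=[\min\{ac,ad,bc,bd\},\max\{ac,ad,bc,bd\}]$. Let $X=[\underline{x}_1,\overline{x}_1]\times\cdots\times[\underline{x}_{n_x},\overline{x}_{n_x}]$ be a box, $h_i=(\overline{x}_i-\underline{x}_i)/N$, and partition each coordinate range into $N$ pieces $X_i^j$ with endpoints $\underline{x}_i+(j-1)h_i$ and $\underline{x}_i+jh_i$. The pieces are taken closed on the left and open on the right for $j<N$, and closed on both sides for $j=N$, so that each $x_i\in[\underline{x}_i,\overline{x}_i]$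 lies in exactly one $X_i^j$. Let $\varphi_i^j(x)=1$ if $x_i\in X_i^j$ and $\varphi_i^j(x)=0$ otherwise. For $A\in\mathbb{I}^{n_x\times N}$ define the interval-valued function $$\Gamma(x,A,X)=\sum_{i=1}^{n_x}\sum_{j=1}^{N}A_i^j\varphi_i^j(x),\qquad x\in X,$$ with sums of intervals (Minkowski sums) given by $[a,b]+[c,d]=[a+c,b+d]$. $\Gamma(\cdot,A,X)$ is called an interval superposition model (ISM) of a function $f:X\to\mathbb{R}$ on $X$ if $f(x)\in\Gamma(x,A,X)$ for all $x\in X$. *)

theory Defs
  imports "HOL-Analysis.Analysis" "HOL-Library.Interval"
begin

(* Rows are indexed by a finite type 'n with CARD('n) = n_x, columns by {1..N}. A matrix in
   I^(n_x x N) is a function on 'n and nat; its values at columns outside {1..N} are never used. *)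
type_synonym 'n interval_matrix = "'n \<Rightarrow> nat \<Rightarrow> real interval"

lemma lower_Interval: "(a::real) \<le> b \<Longrightarrow> lower (Interval (a, b)) = a"
  by (simp add: lower.rep_eq Interval_inverse)

lemma upper_Interval: "(a::real) \<le> b \<Longrightarrow> upper (Interval (a, b)) = b"
  by (simp add: upper.rep_eq Interval_inverse)

definition scale_interval :: "real \<Rightarrow> real interval \<Rightarrow> real interval" where
  "scale_interval c I =
     (if c \<ge> 0 then Interval (c * lower I, c * upper I) else Interval (c * upper I, c * lower I))"

lemma lower_scale_interval:
  "lower (scale_interval c I) = (if c \<ge> 0 then c * lower I else c * upper I)"
  by (simp add: scale_interval_def lower_Interval mult_left_mono mult_left_mono_neg)

lemma upper_scale_interval:
  "upper (scale_interval c I) = (if c \<ge> 0 then c * upper I else c * lower I)"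
  by (simp add: scale_interval_def upper_Interval mult_left_mono mult_left_mono_neg)

definition cell :: "real \<Rightarrow> real \<Rightarrow> nat \<Rightarrow> nat \<Rightarrow> real set" where
  "cell l u N j =
     (let d = (u - l) / real N; p = l + (real j - 1) * d; q = l + real j * d
      in if j < N then {p..<q} else {p..q})"

definition cell_ind ::
  "real ^ 'n \<Rightarrow> real ^ 'n \<Rightarrow> nat \<Rightarrow> 'n \<Rightarrow> nat \<Rightarrow> real ^ 'n::finite \<Rightarrow> real" where
  "cell_ind lo hi N i j x = (if x $ i \<in> cell (lo $ i) (hi $ i) N j then 1 else 0)"

(* The superposition Gamma(x, A, X) for the box X = cbox lo hi. *)
definition superposition ::
  "nat \<Rightarrow> real ^ 'n \<Rightarrow> real ^ 'n \<Rightarrow> 'n interval_matrix \<Rightarrow> real ^ 'n::finite \<Rightarrow> real interval" where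
  "superposition N lo hi A x =
     (\<Sum>i\<in>UNIV. \<Sum>j=1..N. scale_interval (cell_ind lo hi N i j x) (A i j))"

definition is_ISM ::
  "nat \<Rightarrow> real ^ 'n \<Rightarrow> real ^ 'n \<Rightarrow> 'n::finite interval_matrix \<Rightarrow> (real ^ 'n \<Rightarrow> real) \<Rightarrow> bool" where
  "is_ISM N lo hi A f \<longleftrightarrow> (\<forall>x\<in>cbox lo hi. f x \<in> set_of (superposition N lo hi A x))"

definition row_lower :: "nat \<Rightarrow> (nat \<Rightarrow> real interval) \<Rightarrow> real" where
  "row_lower N r = (MIN j\<in>{1..N}. lower (r j))"

definition row_upper :: "nat \<Rightarrow> (nat \<Rightarrow> real interval) \<Rightarrow> real" where
  "row_upper N r = (MAX j\<in>{1..N}. upper (r j))"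

definition row_center :: "nat \<Rightarrow> (nat \<Rightarrow> real interval) \<Rightarrow> real" where
  "row_center N r = (row_upper N r + row_lower N r) / 2"

definition row_radius :: "nat \<Rightarrow> (nat \<Rightarrow> real interval) \<Rightarrow> real" where
  "row_radius N r = (row_upper N r - row_lower N r) / 2"

definition remainder_bound ::
  "nat \<Rightarrow> 'n::finite interval_matrix \<Rightarrow> 'n interval_matrix \<Rightarrow> real" where
  "remainder_bound N A B =
     (\<Sum>i\<in>UNIV. row_radius N (A i)) * (\<Sum>i\<in>UNIV. row_radius N (B i))
     - (\<Sum>i\<in>UNIV. row_radius N (A i) * row_radius N (B i))"

(* The products and differences of real numbers are embedded as degenerate intervals;
   the product of the two sums in parentheses is the interval product. *)
definition product_entry ::
  "nat \<Rightarrow> 'n::finite interval_matrix \<Rightarrow> 'n interval_matrix \<Rightarrow> 'n \<Rightarrow> nat \<Rightarrow> real interval" where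
  "product_entry N A B i j =
     (let ac = (\<lambda>i. row_center N (A i));
          bc = (\<lambda>i. row_center N (B i));
          a = (\<Sum>i\<in>UNIV. ac i);
          b = (\<Sum>i\<in>UNIV. bc i);
          c = (\<Sum>i\<in>UNIV. ac i * bc i);
          \<omega> = (a * b - c) / real CARD('n)
      in (A i j + interval_of a - interval_of (ac i)) * (B i j + interval_of b - interval_of (bc i))
         - interval_of ((a - ac i) * (b - bc i)) - interval_of \<omega>)"

(* C is a possible result of the product rule; the row k that receives the remainder may be any
   maximizer of the total width. *)
definition product_rule ::
  "nat \<Rightarrow> 'n::finite interval_matrix \<Rightarrow> 'n interval_matrix \<Rightarrow> 'n interval_matrix \<Rightarrow> bool" where
  "product_rule N A B C \<longleftrightarrow>
     (\<exists>k. is_arg_max (\<lambda>i. \<Sum>j=1..N. upper (A i j) - lower (A i j)) (\<lambda>i. True) k \<and>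
        (\<forall>i. \<forall>j\<in>{1..N}.
           C i j = (if i = k
                    then product_entry N A B i j
                         + scale_interval (remainder_bound N A B) (Interval (-1, 1))
                    else product_entry N A B i j)))"

end

theory Submission
  imports Defs
begin

text \<open>
  Fix a point \<open>x\<close> of the box. Each coordinate \<open>x $ i\<close> lies in exactly one cell, so
  both superpositions collapse to one interval per row, taken in the same column \<open>J i\<close> for
  \<open>A\<close> and \<open>B\<close> (\<open>superposition_selects_columns\<close>). Minkowski sums consist of sums of
  selections (\<open>mem_interval_sum_iff\<close>), so \<open>g x\<close> is a sum of numbers \<open>\<alpha> i\<close> in
  \<open>A i (J i)\<close>, and \<open>h x\<close> is a sum of numbers \<open>\<beta> i\<close> in \<open>B i (J i)\<close>.

  Expand the product around the row centers \<open>p i\<close>, \<open>q i\<close>, with deviations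
  \<open>\<alpha> i - p i\<close> and \<open>\<beta> i - q i\<close>. Everything except the products of deviations from two
  different rows is additive in the rows. Without \<open>\<omega>\<close> the row terms of the product rule
  would exceed this additive part by \<open>a * b - c\<close> in total, an excess that subtracting
  \<open>\<omega>\<close> in each of the \<open>CARD('n)\<close> rows removes
  (\<open>product_separable_decomposition\<close>). A deviation is at most the row radius in absolute
  value, so the cross terms add up to at most the remainder bound
  (\<open>abs_cross_terms_le\<close>), and the enlarged entries of row \<open>k\<close> absorb them.
\<close>

section \<open>Superpositions at a point\<close>

text \<open>
  For positive cell width \<open>d\<close> the cell is found by rounding \<open>(t - l) / d\<close> down, except that
  the right end point \<open>u\<close> belongs to cell \<open>N\<close>. When \<open>l = u\<close>, the cells before the last
  are empty and the last one is \<open>{l}\<close>.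
\<close>
lemma cell_ex1:
  assumes N: "N \<ge> 1" and t: "l \<le> t" "t \<le> u"
  shows "\<exists>!j. j \<in> {1..N} \<and> t \<in> cell l u N j"
proof (cases "l = u")
  case True
  then have "t \<in> cell l u N j \<longleftrightarrow> N \<le> j" for j
    using t by (auto simp: cell_def)
  then show ?thesis using N by auto
next
  case False
  define d where "d = (u - l) / real N"
  have d: "d > 0" using False t N by (simp add: d_def)
  have uN: "u = l + real N * d" using N by (simp add: d_def)
  have cell: "t \<in> cell l u N j \<longleftrightarrow>
      l + (real j - 1) * d \<le> t \<and> (if j < N then t < l + real j * d else t \<le> l + real j * d)" for j
    by (simp add: cell_def Let_def flip: d_def)
  have lt_cells: False
    if "i < j" "j \<le> N" "t \<in> cell l u N i" "t \<in> cell l u N j" for i j :: nat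
  proof -
    have "real i \<le> real j - 1" using that(1) by linarith
    then have "real i * d \<le> (real j - 1) * d" using d by simp
    then show False using that by (auto simp: cell)
  qed
  have "\<exists>j. j \<in> {1..N} \<and> t \<in> cell l u N j"
  proof (cases "t = u")
    case True
    have "(real N - 1) * d \<le> real N * d" using d by simp
    then have "t \<in> cell l u N N" unfolding cell using True uN by (simp add: algebra_simps)
    then show ?thesis using N by auto
  next
    case False
    define m where "m = nat \<lfloor>(t - l) / d\<rfloor>"
    have nonneg: "(t - l) / d \<ge> 0" using t d by simp
    then have m: "real m \<le> (t - l) / d" "(t - l) / d < real m + 1"
      unfolding m_def by linarith+
    then have md: "real m * d \<le> t - l" "t - l < (real m + 1) * d"
      using d by (simp_all add: field_simps)
    have "real m * d < real N * d" using md(1) False t uN by linarith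
    then have "m < N" using d by simp
    then show ?thesis using md by (intro exI[of _ "Suc m"]) (auto simp: cell algebra_simps)
  qed
  then show ?thesis
    using lt_cells by (metis atLeastAtMost_iff linorder_neqE_nat)
qed

lemma scale_interval_0: "scale_interval 0 I = 0"
  by (simp add: interval_eq_iff lower_scale_interval upper_scale_interval)

lemma scale_interval_1: "scale_interval 1 I = I"
  by (simp add: interval_eq_iff lower_scale_interval upper_scale_interval)

text \<open>
  The columns depend only on the point, not on the matrix: this is what aligns the entries of
  \<open>A\<close>, \<open>B\<close> and \<open>C\<close> at a common point.
\<close>
lemma superposition_selects_columns:
  fixes lo hi x :: "real ^ 'n::finite"
  assumes N: "N \<ge> 1" and x: "x \<in> cbox lo hi"
  obtains J where "\<And>i. J i \<in> {1..N}"
    and "\<And>A. superposition N lo hi A x = (\<Sum>i\<in>UNIV. A i (J i))"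
proof -
  have "\<exists>!j. j \<in> {1..N} \<and> x $ i \<in> cell (lo $ i) (hi $ i) N j" for i
    using x by (intro cell_ex1[OF N]) (auto simp: mem_box_cart)
  then obtain J where J: "\<And>i. J i \<in> {1..N}"
    and cell: "\<And>i j. j \<in> {1..N} \<Longrightarrow> x $ i \<in> cell (lo $ i) (hi $ i) N j \<longleftrightarrow> j = J i"
    by metis
  have "(\<Sum>j=1..N. scale_interval (cell_ind lo hi N i j x) (A i j)) = A i (J i)"
    for A :: "'n interval_matrix" and i
  proof -
    have "(\<Sum>j=1..N. scale_interval (cell_ind lo hi N i j x) (A i j))
        = (\<Sum>j=1..N. if j = J i then A i j else 0)"
      by (intro sum.cong) (auto simp: cell_ind_def cell scale_interval_0 scale_interval_1)
    also have "\<dots> = A i (J i)" using J by (simp add: sum.delta)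
    finally show ?thesis .
  qed
  then show thesis using J by (intro that) (auto simp: superposition_def)
qed

lemma mem_interval_sum_iff:
  fixes I :: "'a \<Rightarrow> real interval"
  assumes "finite S"
  shows "y \<in> set_of (\<Sum>i\<in>S. I i) \<longleftrightarrow> (\<exists>f. (\<forall>i\<in>S. f i \<in> set_of (I i)) \<and> y = sum f S)"
  using assms
proof (induction S arbitrary: y rule: finite_induct)
  case empty
  then show ?case by (simp add: set_of_eq)
next
  case (insert s S)
  show ?case
  proof
    assume "y \<in> set_of (\<Sum>i\<in>insert s S. I i)"
    then obtain v w where y: "y = v + w" and v: "v \<in> set_of (I s)"
      and "w \<in> set_of (\<Sum>i\<in>S. I i)"
      using insert.hyps by (auto elim: plus_in_intervalE)
    then obtain f where "\<forall>i\<in>S. f i \<in> set_of (I i)" "w = sum f S"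
      using insert.IH by blast
    moreover have "sum (f(s := v)) S = sum f S"
      using insert.hyps by (intro sum.cong) auto
    ultimately show "\<exists>f. (\<forall>i\<in>insert s S. f i \<in> set_of (I i)) \<and> y = sum f (insert s S)"
      using y v insert.hyps by (intro exI[of _ "f(s := v)"]) auto
  next
    assume "\<exists>f. (\<forall>i\<in>insert s S. f i \<in> set_of (I i)) \<and> y = sum f (insert s S)"
    then show "y \<in> set_of (\<Sum>i\<in>insert s S. I i)"
      using insert by (auto intro!: plus_in_intervalI)
  qed
qed

section \<open>Separable part and cross terms of a product of sums\<close>

text \<open>
  With the deviations \<open>u i = \<alpha> i - p i\<close> and \<open>v i = \<beta> i - q i\<close> the summand equals
  \<open>a * v i + b * u i + u i * v i + a * q i + b * p i - p i * q i - \<omega>\<close>. Its constant part sums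
  to \<open>2 * a * b - (\<Sum>i\<in>UNIV. p i * q i)\<close> minus \<open>CARD('n)\<close> times \<open>\<omega>\<close>, that is,
  to \<open>a * b\<close>; hence only the cross terms of the product of deviations are left over.
\<close>
lemma product_separable_decomposition:
  fixes \<alpha> \<beta> p q :: "'n::finite \<Rightarrow> real"
  defines "a \<equiv> sum p UNIV" and "b \<equiv> sum q UNIV"
  defines "\<omega> \<equiv> (a * b - (\<Sum>i\<in>UNIV. p i * q i)) / real CARD('n)"
  shows "sum \<alpha> UNIV * sum \<beta> UNIV =
    (\<Sum>i\<in>UNIV. (\<alpha> i + a - p i) * (\<beta> i + b - q i) - (a - p i) * (b - q i) - \<omega>)
    + ((\<Sum>i\<in>UNIV. \<alpha> i - p i) * (\<Sum>i\<in>UNIV. \<beta> i - q i)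
       - (\<Sum>i\<in>UNIV. (\<alpha> i - p i) * (\<beta> i - q i)))"
proof -
  define u v where "u = (\<lambda>i. \<alpha> i - p i)" and "v = (\<lambda>i. \<beta> i - q i)"
  have "(\<Sum>i\<in>UNIV. (\<alpha> i + a - p i) * (\<beta> i + b - q i) - (a - p i) * (b - q i) - \<omega>)
      = (\<Sum>i\<in>UNIV. a * v i + b * u i + u i * v i + a * q i + b * p i - p i * q i - \<omega>)"
    by (intro sum.cong) (auto simp: u_def v_def algebra_simps)
  also have "\<dots> = a * sum v UNIV + b * sum u UNIV + (\<Sum>i\<in>UNIV. u i * v i)
      + a * b + b * a - (\<Sum>i\<in>UNIV. p i * q i) - real CARD('n) * \<omega>"
    by (simp add: sum.distrib sum_subtractf sum_distrib_left a_def b_def)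
  also have "real CARD('n) * \<omega> = a * b - (\<Sum>i\<in>UNIV. p i * q i)"
    by (simp add: \<omega>_def)
  finally have sum_core:
    "(\<Sum>i\<in>UNIV. (\<alpha> i + a - p i) * (\<beta> i + b - q i) - (a - p i) * (b - q i) - \<omega>)
      = a * sum v UNIV + b * sum u UNIV + (\<Sum>i\<in>UNIV. u i * v i) + a * b"
    by simp
  have "sum \<alpha> UNIV = a + sum u UNIV" "sum \<beta> UNIV = b + sum v UNIV"
    by (simp_all add: u_def v_def a_def b_def sum_subtractf)
  then show ?thesis
    unfolding sum_core by (simp add: algebra_simps flip: u_def[THEN fun_cong] v_def[THEN fun_cong])
qed

lemma cross_terms_eq_sum:
  fixes u v :: "'n \<Rightarrow> real"
  assumes "finite S"
  shows "sum u S * sum v S - (\<Sum>i\<in>S. u i * v i) = (\<Sum>i\<in>S. \<Sum>j\<in>S - {i}. u i * v j)"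
proof -
  have "(\<Sum>i\<in>S. \<Sum>j\<in>S - {i}. u i * v j) = (\<Sum>i\<in>S. (\<Sum>j\<in>S. u i * v j) - u i * v i)"
    using assms by (intro sum.cong) (simp_all add: sum_diff1)
  then show ?thesis
    by (simp add: sum_subtractf sum_product)
qed

text \<open>
  The bound is that of the individual products \<open>u i * v j\<close> with \<open>i \<noteq> j\<close>. Bounding the full
  product and the diagonal sum separately would add the diagonal sum of the \<open>r i * s i\<close>
  instead of subtracting it.
\<close>
lemma abs_cross_terms_le:
  fixes u v r s :: "'n \<Rightarrow> real"
  assumes "finite S" and "\<And>i. i \<in> S \<Longrightarrow> \<bar>u i\<bar> \<le> r i" and "\<And>i. i \<in> S \<Longrightarrow> \<bar>v i\<bar> \<le> s i"
  shows "\<bar>sum u S * sum v S - (\<Sum>i\<in>S. u i * v i)\<bar>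
    \<le> sum r S * sum s S - (\<Sum>i\<in>S. r i * s i)"
proof -
  have "\<bar>u i * v j\<bar> \<le> r i * s j" if "i \<in> S" "j \<in> S" for i j
    unfolding abs_mult using assms that by (intro mult_mono') auto
  then show ?thesis
    unfolding cross_terms_eq_sum[OF assms(1)]
    by (intro order_trans[OF sum_abs] sum_mono) auto
qed

lemma abs_diff_row_center_le_radius:
  assumes "j \<in> {1..N}" and "y \<in> set_of (r j)"
  shows "\<bar>y - row_center N r\<bar> \<le> row_radius N r"
proof -
  have "row_lower N r \<le> lower (r j)" "upper (r j) \<le> row_upper N r"
    using assms(1) by (auto simp: row_lower_def row_upper_def)
  then have "row_lower N r \<le> y" "y \<le> row_upper N r"
    using assms(2) by (auto simp: set_of_eq)
  then show ?thesis
    by (simp add: row_center_def row_radius_def abs_le_iff field_simps)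
qed

section \<open>The product rule\<close>

lemma mem_scale_symmetric_interval:
  assumes "\<bar>e\<bar> \<le> R"
  shows "e \<in> set_of (scale_interval R (Interval (-1, 1)))"
  using assms
  by (auto simp: set_of_eq lower_scale_interval upper_scale_interval lower_Interval upper_Interval)

theorem theorem2:
  fixes lo hi :: "real ^ 'n::finite"
    and N :: nat
    and g h :: "real ^ 'n \<Rightarrow> real"
    and A B C :: "'n interval_matrix"
  assumes "N \<ge> 1"
    and "\<And>i. lo $ i \<le> hi $ i"
    and "is_ISM N lo hi A g"
    and "is_ISM N lo hi B h"
    and "product_rule N A B C"
  shows "is_ISM N lo hi C (\<lambda>x. g x * h x)"
  unfolding is_ISM_def
proof
  fix x assume x: "x \<in> cbox lo hi"
  obtain J where J: "\<And>i. J i \<in> {1..N}"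
    and selects: "\<And>A. superposition N lo hi A x = (\<Sum>i\<in>UNIV. A i (J i))"
    using superposition_selects_columns[OF assms(1) x] by blast
  obtain \<alpha> where \<alpha>: "\<And>i. \<alpha> i \<in> set_of (A i (J i))" and g: "g x = sum \<alpha> UNIV"
    using assms(3)[unfolded is_ISM_def, rule_format, OF x]
    unfolding selects mem_interval_sum_iff[OF finite] by blast
  obtain \<beta> where \<beta>: "\<And>i. \<beta> i \<in> set_of (B i (J i))" and h: "h x = sum \<beta> UNIV"
    using assms(4)[unfolded is_ISM_def, rule_format, OF x]
    unfolding selects mem_interval_sum_iff[OF finite] by blast
  obtain k where C: "\<And>i j. j \<in> {1..N} \<Longrightarrow> C i j = (if i = k
      then product_entry N A B i j + scale_interval (remainder_bound N A B) (Interval (-1, 1))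
      else product_entry N A B i j)"
    using assms(5) by (auto simp: product_rule_def)

  define p q where "p = (\<lambda>i. row_center N (A i))" and "q = (\<lambda>i. row_center N (B i))"
  define a b where "a = sum p UNIV" and "b = sum q UNIV"
  define \<omega> where "\<omega> = (a * b - (\<Sum>i\<in>UNIV. p i * q i)) / real CARD('n)"
  define core where "core i =
    (\<alpha> i + a - p i) * (\<beta> i + b - q i) - (a - p i) * (b - q i) - \<omega>" for i
  define e where "e = (\<Sum>i\<in>UNIV. \<alpha> i - p i) * (\<Sum>i\<in>UNIV. \<beta> i - q i)
    - (\<Sum>i\<in>UNIV. (\<alpha> i - p i) * (\<beta> i - q i))"

  have core: "core i \<in> set_of (product_entry N A B i (J i))" for i
    unfolding product_entry_def Let_def core_def \<omega>_def a_def b_def p_def q_def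
    by (intro minus_in_intervalI times_in_intervalI plus_in_intervalI
        in_interval_to_interval \<alpha> \<beta>)
  have "\<bar>\<alpha> i - p i\<bar> \<le> row_radius N (A i)" for i
    unfolding p_def by (rule abs_diff_row_center_le_radius[where j = "J i" and r = "A i", OF J \<alpha>])
  moreover have "\<bar>\<beta> i - q i\<bar> \<le> row_radius N (B i)" for i
    unfolding q_def by (rule abs_diff_row_center_le_radius[where j = "J i" and r = "B i", OF J \<beta>])
  ultimately have "\<bar>e\<bar> \<le> remainder_bound N A B"
    unfolding e_def remainder_bound_def by (intro abs_cross_terms_le) auto
  then have e: "e \<in> set_of (scale_interval (remainder_bound N A B) (Interval (-1, 1)))"
    by (rule mem_scale_symmetric_interval)

  have "g x * h x = sum core UNIV + e"
    unfolding g h core_def e_def a_def b_def \<omega>_def by (rule product_separable_decomposition)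
  also have "\<dots> = (\<Sum>i\<in>UNIV. core i + (if i = k then e else 0))"
    by (simp add: sum.distrib)
  finally have "g x * h x = (\<Sum>i\<in>UNIV. core i + (if i = k then e else 0))" .
  moreover have "core i + (if i = k then e else 0) \<in> set_of (C i (J i))" for i
    using core e by (auto simp: C[OF J] intro: plus_in_intervalI)
  ultimately show "g x * h x \<in> set_of (superposition N lo hi C x)"
    unfolding selects mem_interval_sum_iff[OF finite]
    by (intro exI[of _ "\<lambda>i. core i + (if i = k then e else 0)"] conjI ballI)
qed

end
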